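(* Let $d\ge1$ and let $X_1,X_2,\dots$ be i.i.d. random vectors in $\mathbb{R}^d$ with density $f\in\mathcal{P}_{C,4}$ for some $C<\infty$. Suppose the kernel $K:\mathbb{R}^d\to\mathbb{R}$ has the form $K(t)=\Phi(\|t\|^2)$ for some real function $\Phi$ with uniformly bounded second order derivative and with support contained in $[0,T]$, $T<\infty$, and that $K$ is non-negative and integrates to $1$. Let $c>0$, let $p:\mathbb{R}\to\mathbb{R}$ be a clipping function, that is, $p(s)\ge1$ for all $s$ and $p(s)=s$ for all $s\ge t_0$ for some $1\le t_0<\infty$, with five bounded and uniformly continuous derivatives, and set $\alpha(s)=c\,p^{1/2}(s/c^2)$. Let $h=h_{2,n}>0$ with $h\to0$ and $nh^d\to\infty$ as $n\to\infty$, and let $$\bar f(t;h)=\frac{1}{nh^d}\sum_{i=1}^n\alpha^d(f(X_i))K\bigl(h^{-1}\alpha(f(X_i))(t-X_i)\bigr).$$ Then for every $t\in\mathbb{R}^d$ with $f(t)>t_0c^2$, as $n\to\infty$, $$\operatorname{Var}\bar f(t;h)=\frac{\alpha^d(f(t))f(t)\mu_0}{nh^d}(1+o(1)),\qquad \mu_0=\int_{\mathbb{R}^d}K^2(u)\,du.$$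
   Context: $\mathcal{P}_{C,k}$ is the set of probability densities on $\mathbb{R}^d$ which, together with all their partial derivatives of order $k$ or lower, are bounded by $C<\infty$ and are uniformly continuous. $\alpha^d(s)$ means $(\alpha(s))^d$. $\Phi$ is regarded as a function on $[0,\infty)$. *)

theory Defs
  imports "HOL-Probability.Probability" "HOL-Library.Landau_Symbols"
begin

text \<open>The value of \<open>f\<close> and all its iterated partial derivatives of order at most \<open>k\<close> exist
  everywhere, are bounded by \<open>C\<close> in absolute value and are uniformly continuous.\<close>

fun bounded_uc_partials :: "real \<Rightarrow> nat \<Rightarrow> (real ^ 'd \<Rightarrow> real) \<Rightarrow> bool" where
  "bounded_uc_partials C 0 f \<longleftrightarrow>
     (\<forall>x. \<bar>f x\<bar> \<le> C) \<and> uniformly_continuous_on UNIV f"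
| "bounded_uc_partials C (Suc k) f \<longleftrightarrow>
     (\<forall>x. \<bar>f x\<bar> \<le> C) \<and> uniformly_continuous_on UNIV f \<and>
     (\<forall>i. \<exists>g. (\<forall>x. ((\<lambda>s. f (x + s *\<^sub>R axis i 1)) has_real_derivative g x) (at 0)) \<and>
          bounded_uc_partials C k g)"

definition density_class :: "real \<Rightarrow> nat \<Rightarrow> (real ^ 'd \<Rightarrow> real) set" where
  "density_class C k =
     {f. (\<forall>x. 0 \<le> f x) \<and> integrable lborel f \<and> (LINT x|lborel. f x) = 1 \<and>
         bounded_uc_partials C k f}"

text \<open>\<open>\<Phi>\<close> is only considered on \<open>[0,\<infinity>)\<close>; in particular its derivatives at \<open>0\<close> are one-sided
  and its values at negative arguments are irrelevant.\<close>

definition bounded_second_deriv :: "(real \<Rightarrow> real) \<Rightarrow> bool" where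
  "bounded_second_deriv \<Phi> \<longleftrightarrow>
     (\<exists>\<Phi>1 \<Phi>2 B. \<forall>s\<ge>0.
        (\<Phi> has_real_derivative \<Phi>1 s) (at s within {0..}) \<and>
        (\<Phi>1 has_real_derivative \<Phi>2 s) (at s within {0..}) \<and>
        \<bar>\<Phi>2 s\<bar> \<le> B)"

text \<open>\<open>p\<close> itself is unbounded, so only the derivatives of orders 1 to 5 are required to be bounded.\<close>

definition clipping_function :: "real \<Rightarrow> (real \<Rightarrow> real) \<Rightarrow> bool" where
  "clipping_function t0 p \<longleftrightarrow>
     1 \<le> t0 \<and> (\<forall>s. 1 \<le> p s) \<and> (\<forall>s\<ge>t0. p s = s) \<and>
     (\<exists>D :: nat \<Rightarrow> real \<Rightarrow> real. D 0 = p \<and>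
        (\<forall>j<5. \<forall>s. (D j has_real_derivative D (Suc j) s) (at s)) \<and>
        (\<forall>j\<in>{1..5}. bounded (range (D j)) \<and> uniformly_continuous_on UNIV (D j)))"

definition bandwidth_factor :: "real \<Rightarrow> (real \<Rightarrow> real) \<Rightarrow> real \<Rightarrow> real" where
  "bandwidth_factor c p s = c * sqrt (p (s / c\<^sup>2))"

definition ideal_estimator ::
  "(real \<Rightarrow> real) \<Rightarrow> (real ^ 'd \<Rightarrow> real) \<Rightarrow> (real ^ 'd \<Rightarrow> real) \<Rightarrow> (nat \<Rightarrow> 'w \<Rightarrow> real ^ 'd) \<Rightarrow>
   nat \<Rightarrow> real \<Rightarrow> real ^ 'd \<Rightarrow> 'w \<Rightarrow> real" where
  "ideal_estimator \<alpha> K f X n h t \<omega> =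
     1 / (real n * h ^ CARD('d)) *
     (\<Sum>i=1..n. \<alpha> (f (X i \<omega>)) ^ CARD('d) *
        K ((inverse h * \<alpha> (f (X i \<omega>))) *\<^sub>R (t - X i \<omega>)))"

end

(* The substitution x = t - h u turns the m-th moment (m = 1, 2) of one summand into h^d times an
   integral which converges by dominated convergence, because alpha >= c > 0 confines the rescaled
   kernel to a fixed ball. So the second moment is of order h^d and the squared mean, of order h^(2d),
   is negligible. *)

theory Submission imports Defs begin

section \<open>Variance of a finite sum of independent square-integrable variables\<close>

lemma (in prob_space) variance_sum_indep:
  fixes Y :: "'i \<Rightarrow> 'a \<Rightarrow> real"
  assumes indep: "indep_vars (\<lambda>_. borel) Y I"
    and fin: "finite I"
    and int: "\<And>i. i \<in> I \<Longrightarrow> integrable M (Y i)"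
    and sq: "\<And>i. i \<in> I \<Longrightarrow> integrable M (\<lambda>\<omega>. (Y i \<omega>)\<^sup>2)"
  shows "variance (\<lambda>\<omega>. \<Sum>i\<in>I. Y i \<omega>) = (\<Sum>i\<in>I. variance (Y i))"
proof -
  define Z where "Z i \<omega> = Y i \<omega> - expectation (Y i)" for i \<omega>
  have Zint: "integrable M (Z i)" and Zmean: "expectation (Z i) = 0" if "i \<in> I" for i
    unfolding Z_def using int[OF that] by (simp_all add: prob_space)
  have Zsq: "integrable M (\<lambda>\<omega>. (Z i \<omega>)\<^sup>2)" if "i \<in> I" for i
    unfolding Z_def power2_diff using int[OF that] sq[OF that] by auto
  have Zind: "indep_vars (\<lambda>_. borel) Z I"
    unfolding Z_def by (rule indep_vars_compose2[OF indep]) auto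
  \<comment> \<open>Independence factorises the expectation of a product taken over an index set.
    For i = j the set \<open>{i, j}\<close> collapses and the product is no longer a square, so the
    diagonal is treated separately in \<open>cross\<close>; off the diagonal both factors have mean
    0.\<close>
  have prod_eq: "(\<Prod>k\<in>{i, j}. Z k \<omega>) = Z i \<omega> * Z j \<omega>" if "i \<noteq> j" for i j \<omega>
    using that by simp
  have cross: "integrable M (\<lambda>\<omega>. Z i \<omega> * Z j \<omega>)"
    "expectation (\<lambda>\<omega>. Z i \<omega> * Z j \<omega>) = (if i = j then variance (Y i) else 0)"
    if ij: "i \<in> I" "j \<in> I" for i j
  proof -
    consider "i = j" | "i \<noteq> j" by blast
    then have "integrable M (\<lambda>\<omega>. Z i \<omega> * Z j \<omega>) \<and>
      expectation (\<lambda>\<omega>. Z i \<omega> * Z j \<omega>) = (if i = j then variance (Y i) else 0)"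
    proof cases
      case 1
      then show ?thesis
        using Zsq[OF ij(1)] by (simp add: power2_eq_square Z_def)
    next
      case 2
      have ind: "indep_vars (\<lambda>_. borel) Z {i, j}"
        by (rule indep_vars_subset[OF Zind]) (use ij in auto)
      have zint: "\<And>k. k \<in> {i, j} \<Longrightarrow> integrable M (Z k)"
        using ij Zint by auto
      show ?thesis
        using indep_vars_lebesgue_integral[OF _ ind zint] indep_vars_integrable[OF _ ind zint]
          2 Zmean[OF ij(1)] by (simp add: prod_eq)
    qed
    then show "integrable M (\<lambda>\<omega>. Z i \<omega> * Z j \<omega>)"
      "expectation (\<lambda>\<omega>. Z i \<omega> * Z j \<omega>) = (if i = j then variance (Y i) else 0)"
      by blast+
  qed
  have "(\<Sum>i\<in>I. Y i \<omega>) - expectation (\<lambda>\<omega>. \<Sum>i\<in>I. Y i \<omega>) = (\<Sum>i\<in>I. Z i \<omega>)" for \<omega>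
    using int by (simp add: Z_def sum_subtractf)
  then have "variance (\<lambda>\<omega>. \<Sum>i\<in>I. Y i \<omega>) = expectation (\<lambda>\<omega>. (\<Sum>i\<in>I. Z i \<omega>)\<^sup>2)"
    by simp
  also have "\<dots> = expectation (\<lambda>\<omega>. \<Sum>i\<in>I. \<Sum>j\<in>I. Z i \<omega> * Z j \<omega>)"
    by (simp add: power2_eq_square sum_product)
  also have "\<dots> = (\<Sum>i\<in>I. \<Sum>j\<in>I. expectation (\<lambda>\<omega>. Z i \<omega> * Z j \<omega>))"
    using cross(1) by (subst Bochner_Integration.integral_sum; auto intro!: sum.cong Bochner_Integration.integral_sum)
  also have "\<dots> = (\<Sum>i\<in>I. \<Sum>j\<in>I. if i = j then variance (Y i) else 0)"
    by (intro sum.cong cross(2)) auto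
  also have "\<dots> = (\<Sum>i\<in>I. variance (Y i))"
    using fin by (intro sum.cong) auto
  finally show ?thesis .
qed

section \<open>Integrals against a kernel with shrinking, location-dependent bandwidth\<close>

lemma integral_lborel_affine:
  fixes g :: "'a::euclidean_space \<Rightarrow> real"
  assumes [measurable]: "g \<in> borel_measurable borel" and c: "c \<noteq> 0"
  shows "(LINT x|lborel. g x) = \<bar>c\<bar> ^ DIM('a) * (LINT x|lborel. g (t + c *\<^sub>R x))"
proof -
  \<comment> \<open>Lebesgue measure is the image of itself under x -> t + c x, weighted by |c| to
    the dimension. If g is not integrable, both sides of the lemma are 0 by convention.\<close>
  have "(LINT x|lborel. g x) =
    (LINT x|density (distr lborel borel (\<lambda>x. t + c *\<^sub>R x)) (\<lambda>_. ennreal (\<bar>c\<bar> ^ DIM('a))). g x)"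
    using lborel_affine[OF c, of t] by (simp add: ennreal_power)
  also have "\<dots> = \<bar>c\<bar> ^ DIM('a) * (LINT x|lborel. g (t + c *\<^sub>R x))"
    by (subst integral_density) (auto simp: integral_distr)
  finally show ?thesis .
qed

lemma bounded_range_compact_support:
  fixes L :: "'a::euclidean_space \<Rightarrow> real"
  assumes cont: "continuous_on UNIV L" and supp: "\<And>x. norm x > R \<Longrightarrow> L x = 0"
  obtains B where "B \<ge> 0" "\<And>x. \<bar>L x\<bar> \<le> B"
proof -
  have "bounded (L ` cball 0 R)"
    by (intro compact_imp_bounded compact_continuous_image continuous_on_subset[OF cont]) auto
  then obtain B where "\<forall>y \<in> L ` cball 0 R. norm y \<le> B"
    unfolding bounded_iff by blast
  then have B: "\<bar>L x\<bar> \<le> B" if "norm x \<le> R" for x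
    using that by auto
  have "\<bar>L x\<bar> \<le> max 0 B" for x
    using B[of x] supp[of x] by (cases "norm x \<le> R") auto
  then show thesis by (rule that[rotated]) simp
qed

text \<open>Weight and kernel are left general so that one limit serves both moments:
  \<open>w\<close> = f a^d with \<open>L\<close> = K, and \<open>w\<close> = f a^(2d) with
  \<open>L\<close> = K^2. As the bandwidth shrinks, \<open>a\<close> and \<open>w\<close> freeze at
  t; the power of \<open>a t\<close> in the denominator is the Jacobian of u -> \<open>a t\<close>
  u.\<close>

lemma tendsto_integral_localized_kernel:
  fixes a w L :: "'a::euclidean_space \<Rightarrow> real"
  assumes a: "continuous_on UNIV a" "\<And>x. c \<le> a x" "c > 0"
    and w: "continuous_on UNIV w" "\<And>x. \<bar>w x\<bar> \<le> W"
    and L: "continuous_on UNIV L" "\<And>x. norm x > R \<Longrightarrow> L x = 0"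
    and h: "h \<longlonglongrightarrow> 0" "eventually (\<lambda>n. h n > 0) sequentially"
  shows "(\<lambda>n. (LINT x|lborel. w x * L ((inverse (h n) * a x) *\<^sub>R (t - x))) / h n ^ DIM('a))
    \<longlonglongrightarrow> w t * (LINT u|lborel. L u) / a t ^ DIM('a)"
proof -
  have [measurable]: "a \<in> borel_measurable borel" "w \<in> borel_measurable borel" "L \<in> borel_measurable borel"
    using a w L by (auto intro: borel_measurable_continuous_onI)
  obtain B where B: "B \<ge> 0" "\<And>x. \<bar>L x\<bar> \<le> B"
    using bounded_range_compact_support[OF L] by blast
  have at: "a t > 0" using a(2)[of t] a(3) by simp
  have W: "W \<ge> 0" using w(2)[of t] by linarith
  define S where "S n u = w (t - h n *\<^sub>R u) * L (a (t - h n *\<^sub>R u) *\<^sub>R u)" for n u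
  have lim: "(\<lambda>n. LINT u|lborel. S n u) \<longlonglongrightarrow> (LINT u|lborel. w t * L (a t *\<^sub>R u))"
  proof (rule integral_dominated_convergence)
    \<comment> \<open>The radius R / c works for all n at once: if norm u > R / c, then a(...) norm
      u > R because a >= c, and \<open>L\<close> vanishes there. No sign of \<open>h n\<close>
      enters this bound.\<close>
    show "integrable lborel (\<lambda>u::'a. W * B * indicator (cball 0 (R / c)) u)"
      using emeasure_lborel_cball_finite[of "0::'a" "R / c"]
      by (intro integrable_mult_right integrable_real_indicator) auto
    show "AE u in lborel. (\<lambda>n. S n u) \<longlonglongrightarrow> w t * L (a t *\<^sub>R u)"
    proof (rule AE_I2)
      fix u
      have "(\<lambda>n. t - h n *\<^sub>R u) \<longlonglongrightarrow> t - 0 *\<^sub>R u"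
        by (intro tendsto_intros h)
      then have x: "(\<lambda>n. t - h n *\<^sub>R u) \<longlonglongrightarrow> t" by simp
      have "isCont w t" "isCont a t" "isCont L (a t *\<^sub>R u)"
        using a w L by (auto simp: continuous_on_eq_continuous_at)
      with x show "(\<lambda>n. S n u) \<longlonglongrightarrow> w t * L (a t *\<^sub>R u)"
        unfolding S_def by (intro tendsto_intros isCont_tendsto_compose[of _ w]
          isCont_tendsto_compose[of _ a] isCont_tendsto_compose[of _ L]) auto
    qed
    show "AE u in lborel. norm (S n u) \<le> W * B * indicator (cball 0 (R / c)) u" for n
    proof (rule AE_I2)
      fix u
      define b where "b = a (t - h n *\<^sub>R u)"
      have b: "c \<le> b" by (simp add: b_def a)
      show "norm (S n u) \<le> W * B * indicator (cball 0 (R / c)) u"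
      proof (cases "norm u \<le> R / c")
        case True
        then show ?thesis
          by (auto simp: S_def abs_mult W intro!: mult_mono B w)
      next
        case False
        then have "R < c * norm u" using a(3) by (simp add: field_simps)
        also have "\<dots> \<le> norm (b *\<^sub>R u)" using b a(3) by (simp add: mult_right_mono)
        finally have "L (b *\<^sub>R u) = 0" by (rule L)
        then show ?thesis by (simp add: S_def b_def W B)
      qed
    qed
  qed (simp_all add: S_def)
  have "(LINT u|lborel. L u) = \<bar>a t\<bar> ^ DIM('a) * (LINT u|lborel. L (0 + a t *\<^sub>R u))"
    using at by (intro integral_lborel_affine) auto
  then have val: "(LINT u|lborel. w t * L (a t *\<^sub>R u)) = w t * (LINT u|lborel. L u) / a t ^ DIM('a)"
    using at by simp
  have "eventually (\<lambda>n. (LINT u|lborel. S n u) =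
    (LINT x|lborel. w x * L ((inverse (h n) * a x) *\<^sub>R (t - x))) / h n ^ DIM('a)) sequentially"
    using h(2)
  proof eventually_elim
    case (elim n)
    \<comment> \<open>The scaling factor is \<open>- h n\<close>, matching x = t - h u. Since
      \<open>h n\<close> > 0, the absolute value restores \<open>h n\<close>, and
      \<open>inverse (h n)\<close> cancels the factor coming from t - x.\<close>
    have "(LINT x|lborel. w x * L ((inverse (h n) * a x) *\<^sub>R (t - x))) = \<bar>- h n\<bar> ^ DIM('a) *
      (LINT u|lborel. w (t + (- h n) *\<^sub>R u) *
         L ((inverse (h n) * a (t + (- h n) *\<^sub>R u)) *\<^sub>R (t - (t + (- h n) *\<^sub>R u))))"
      using elim by (intro integral_lborel_affine) auto
    also have "\<dots> = h n ^ DIM('a) * (LINT u|lborel. S n u)"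
    proof -
      have cancel: "inverse (h n) * b * h n = b" for b
        using elim by simp
      show ?thesis using elim by (simp add: S_def cancel)
    qed
    finally show ?case using elim by simp
  qed
  with lim val show ?thesis by (simp add: tendsto_cong)
qed

section \<open>Regularity and bounds for the kernel and the bandwidth factor\<close>

lemma continuous_on_kernel_of_norm:
  fixes K :: "'a::real_normed_vector \<Rightarrow> real"
  assumes "bounded_second_deriv \<Phi>" and K: "\<And>x. K x = \<Phi> ((norm x)\<^sup>2)"
  shows "continuous_on UNIV K"
proof -
  from assms(1) obtain \<Phi>1 where
    "\<And>s. s \<ge> 0 \<Longrightarrow> (\<Phi> has_real_derivative \<Phi>1 s) (at s within {0..})"
    unfolding bounded_second_deriv_def by blast
  \<comment> \<open>The one-sided derivatives give continuity on [0, infinity), which contains all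
    values of the squared norm.\<close>
  then have "continuous_on {0..} \<Phi>"
    by (auto intro: DERIV_continuous_on)
  then have "continuous_on UNIV (\<lambda>x::'a. \<Phi> ((norm x)\<^sup>2))"
    by (rule continuous_on_compose2) (auto intro!: continuous_intros)
  then show ?thesis by (simp add: K)
qed

lemma continuous_on_clipping_function:
  assumes "clipping_function t0 p"
  shows "continuous_on A p"
proof -
  from assms obtain D :: "nat \<Rightarrow> real \<Rightarrow> real" where D: "D 0 = p"
    "\<And>j s. j < 5 \<Longrightarrow> (D j has_real_derivative D (Suc j) s) (at s)"
    unfolding clipping_function_def by blast
  have "continuous_on UNIV p"
    using D(2)[of 0] D(1) by (auto intro: DERIV_continuous_on)
  then show ?thesis by (rule continuous_on_subset) simp
qed

lemma continuous_on_bandwidth_factor: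
  assumes "clipping_function t0 p"
  shows "continuous_on A (bandwidth_factor c p)"
proof -
  have "continuous_on UNIV p" by (rule continuous_on_clipping_function[OF assms])
  \<comment> \<open>Multiplication by the constant \<open>inverse (c\<^sup>2)\<close> is continuous
    without a side condition c \<noteq> 0.\<close>
  then have "continuous_on A (\<lambda>s. p (s * inverse (c\<^sup>2)))"
    by (rule continuous_on_compose2) (auto intro!: continuous_intros)
  then have "continuous_on A (\<lambda>s. c * sqrt (p (s * inverse (c\<^sup>2))))"
    by (intro continuous_intros)
  then show ?thesis by (simp add: bandwidth_factor_def[abs_def] divide_inverse)
qed

text \<open>Clipping at p >= 1 makes the square root at least 1. This supplies the uniform lower
  bound that confines the rescaled kernel to a fixed ball.\<close>

lemma bandwidth_factor_ge:
  assumes "clipping_function t0 p" "c > 0"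
  shows "c \<le> bandwidth_factor c p s"
  using assms by (auto simp: bandwidth_factor_def clipping_function_def)

text \<open>Allows division by \<mu>_0: a nonnegative integrand with integral 0 vanishes almost
  everywhere, so K would vanish almost everywhere and have integral 0.\<close>

lemma integral_square_pos:
  fixes K :: "'a::euclidean_space \<Rightarrow> real"
  assumes "integrable lborel (\<lambda>x. (K x)\<^sup>2)" "(LINT x|lborel. K x) \<noteq> 0"
  shows "(LINT x|lborel. (K x)\<^sup>2) > 0"
proof -
  have "(LINT x|lborel. (K x)\<^sup>2) \<noteq> 0"
  proof
    assume "(LINT x|lborel. (K x)\<^sup>2) = 0"
    then have "AE x in lborel. K x = 0"
      using integral_nonneg_eq_0_iff_AE[OF assms(1)] by simp
    then have "(LINT x|lborel. K x) = 0"
      by (rule integral_eq_zero_AE)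
    with assms(2) show False by simp
  qed
  moreover have "(LINT x|lborel. (K x)\<^sup>2) \<ge> 0"
    by simp
  ultimately show ?thesis by linarith
qed

section \<open>Asymptotics of the variance of the ideal estimator\<close>

theorem mainTheorem4:
  fixes M :: "'w measure"
    and X :: "nat \<Rightarrow> 'w \<Rightarrow> real ^ 'd"
    and f K :: "real ^ 'd \<Rightarrow> real"
    and \<Phi> p :: "real \<Rightarrow> real"
    and h :: "nat \<Rightarrow> real"
    and C T c t0 :: real
    and t :: "real ^ 'd"
  assumes "prob_space M"
    and "f \<in> density_class C 4"
    and "prob_space.indep_vars M (\<lambda>_. borel) X {1..}"
    and "\<And>i. i \<ge> 1 \<Longrightarrow> distributed M lborel (X i) (\<lambda>x. ennreal (f x))"
    and "\<And>x. K x = \<Phi> ((norm x)\<^sup>2)"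
    and "bounded_second_deriv \<Phi>"
    and "closure {s. 0 \<le> s \<and> \<Phi> s \<noteq> 0} \<subseteq> {0..T}"
    and "\<And>x. 0 \<le> K x"
    and "integrable lborel K" and "(LINT x|lborel. K x) = 1"
    and "c > 0"
    and "clipping_function t0 p"
    and "\<And>n. n \<ge> 1 \<Longrightarrow> h n > 0"
    and "h \<longlonglongrightarrow> 0"
    and "filterlim (\<lambda>n. real n * h n ^ CARD('d)) at_top sequentially"
    and "f t > t0 * c\<^sup>2"
  shows "\<exists>\<epsilon> \<in> o(\<lambda>_. 1). \<forall>n\<ge>1.
    prob_space.variance M (ideal_estimator (bandwidth_factor c p) K f X n (h n) t) =
      bandwidth_factor c p (f t) ^ CARD('d) * f t * (LINT u|lborel. (K u)\<^sup>2)
        / (real n * h n ^ CARD('d)) * (1 + \<epsilon> n)"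
proof -
  interpret prob_space M by fact
  let ?\<alpha> = "bandwidth_factor c p"
  let ?d = "CARD('d)"
  let ?\<mu> = "LINT u|lborel. (K u)\<^sup>2"
  define a where "a x = ?\<alpha> (f x)" for x
  \<comment> \<open>One summand as a function of the observation. The index m enters through the
    bandwidth alone and stays separate from the number of summands until \<open>var_est\<close> sets
    both to n.\<close>
  define g where "g m x = a x ^ ?d * K ((inverse (h m) * a x) *\<^sub>R (t - x))" for m x
  note f_class = assms(2)[unfolded density_class_def, simplified]
  have f_nonneg: "0 \<le> f x" for x using f_class by blast
  have fC: "f x \<le> C" for x
    using f_class by (auto simp: numeral_eq_Suc abs_le_iff)
  have f_cont: "continuous_on UNIV f"
    using f_class by (auto simp: numeral_eq_Suc intro: uniformly_continuous_imp_continuous)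
  have a_cont: "continuous_on UNIV a"
    unfolding a_def
    by (rule continuous_on_compose2[OF continuous_on_bandwidth_factor[OF assms(12), of UNIV] f_cont]) simp
  have a_ge: "c \<le> a x" for x
    unfolding a_def by (rule bandwidth_factor_ge[OF assms(12,11)])
  then have a_pos: "0 < a x" for x
    using assms(11) less_le_trans by blast
  \<comment> \<open>The bandwidth factor is unbounded on the real line, but f takes values in the
    compact interval [0, C], so continuity bounds \<open>a\<close>.\<close>
  have "bounded (?\<alpha> ` {0..C})"
    by (intro compact_imp_bounded compact_continuous_image
        continuous_on_bandwidth_factor[OF assms(12)]) simp
  then obtain A where "\<forall>y \<in> ?\<alpha> ` {0..C}. norm y \<le> A"
    unfolding bounded_iff by blast
  then have aA: "\<bar>a x\<bar> \<le> A" for x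
    using f_nonneg fC by (auto simp: a_def)
  have A: "A \<ge> 0" using aA[of t] by linarith
  have K_cont: "continuous_on UNIV K"
    by (rule continuous_on_kernel_of_norm[OF assms(6,5)])
  \<comment> \<open>T carries no sign condition; with the absolute value the squared radius is |T|
    >= T in every case.\<close>
  have K_supp: "K x = 0" if "norm x > sqrt \<bar>T\<bar>" for x
  proof (rule ccontr)
    assume "K x \<noteq> 0"
    then have "(norm x)\<^sup>2 \<in> {s. 0 \<le> s \<and> \<Phi> s \<noteq> 0}" by (simp add: assms(5))
    then have "(norm x)\<^sup>2 \<in> {0..T}"
      by (intro subsetD[OF assms(7)] subsetD[OF closure_subset])
    then have "(norm x)\<^sup>2 \<le> T" by simp
    moreover have "(norm x)\<^sup>2 > (sqrt \<bar>T\<bar>)\<^sup>2"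
      using that by (intro power_strict_mono) auto
    ultimately show False by simp
  qed
  obtain B where B: "B \<ge> 0" "\<And>x. \<bar>K x\<bar> \<le> B"
    using bounded_range_compact_support[OF K_cont K_supp] by blast
  have [measurable]: "f \<in> borel_measurable borel" "a \<in> borel_measurable borel"
    "K \<in> borel_measurable borel"
    using f_cont a_cont K_cont by (auto intro: borel_measurable_continuous_onI)
  have g_meas [measurable]: "g m \<in> borel_measurable borel" for m
    unfolding g_def by measurable
  have X_meas: "X i \<in> borel_measurable M" if "i \<ge> 1" for i
    using distributed_measurable[OF assms(4)[OF that]] by simp
  have g_bound: "\<bar>g m x\<bar> \<le> A ^ ?d * B" for m x
    unfolding g_def abs_mult power_abs
    using A aA B by (intro mult_mono power_mono) auto
  have g_int: "integrable M (\<lambda>\<omega>. g m (X i \<omega>))" and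
    g_sq_int: "integrable M (\<lambda>\<omega>. (g m (X i \<omega>))\<^sup>2)" if "i \<ge> 1" for i m
  proof -
    note [measurable] = X_meas[OF that]
    show "integrable M (\<lambda>\<omega>. g m (X i \<omega>))"
      using g_bound by (intro integrable_const_bound[where B="A ^ ?d * B"]) auto
    show "integrable M (\<lambda>\<omega>. (g m (X i \<omega>))\<^sup>2)"
      using power_mono[OF g_bound, of _ _ 2]
      by (intro integrable_const_bound[where B="(A ^ ?d * B)\<^sup>2"]) auto
  qed
  \<comment> \<open>All \<open>X i\<close> with i >= 1 have the density f, so these moments do not
    depend on i. Identical distribution enters here.\<close>
  define E1 E2 where "E1 m = (LINT x|lborel. f x * g m x)"
    and "E2 m = (LINT x|lborel. f x * (g m x)\<^sup>2)" for m
  have var_g: "variance (\<lambda>\<omega>. g m (X i \<omega>)) = E2 m - (E1 m)\<^sup>2" if "i \<ge> 1" for i m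
  proof -
    have "E1 m = expectation (\<lambda>\<omega>. g m (X i \<omega>))"
      unfolding E1_def by (rule distributed_integral[OF assms(4)[OF that]]) (auto simp: f_nonneg)
    moreover have "E2 m = expectation (\<lambda>\<omega>. (g m (X i \<omega>))\<^sup>2)"
      unfolding E2_def by (rule distributed_integral[OF assms(4)[OF that]]) (auto simp: f_nonneg)
    ultimately show ?thesis
      using variance_eq[OF g_int[OF that] g_sq_int[OF that]] by simp
  qed
  have var_sum: "variance (\<lambda>\<omega>. \<Sum>i=1..n. g m (X i \<omega>)) = real n * (E2 m - (E1 m)\<^sup>2)" for n m
  proof -
    have "indep_vars (\<lambda>_. borel) (\<lambda>i \<omega>. g m (X i \<omega>)) {1..n}"
      by (rule indep_vars_compose2[OF indep_vars_subset[OF assms(3)]]) auto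
    then have "variance (\<lambda>\<omega>. \<Sum>i=1..n. g m (X i \<omega>)) = (\<Sum>i=1..n. variance (\<lambda>\<omega>. g m (X i \<omega>)))"
      by (intro variance_sum_indep) (auto intro: g_int g_sq_int)
    also have "\<dots> = (\<Sum>i=1..n. E2 m - (E1 m)\<^sup>2)"
      by (intro sum.cong var_g) auto
    finally show ?thesis by simp
  qed
  have var_est: "variance (ideal_estimator ?\<alpha> K f X n (h n) t) =
      (E2 n - (E1 n)\<^sup>2) / (real n * (h n ^ ?d)\<^sup>2)" if "n \<ge> 1" for n
  proof -
    have "ideal_estimator ?\<alpha> K f X n (h n) t =
        (\<lambda>\<omega>. 1 / (real n * h n ^ ?d) * (\<Sum>i=1..n. g n (X i \<omega>)))"
      by (simp add: ideal_estimator_def[abs_def] g_def a_def)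
    then have "variance (ideal_estimator ?\<alpha> K f X n (h n) t) =
        (1 / (real n * h n ^ ?d))\<^sup>2 * variance (\<lambda>\<omega>. \<Sum>i=1..n. g n (X i \<omega>))"
      by (simp only: integral_mult_right_zero right_diff_distrib[symmetric] power_mult_distrib)
    also have "\<dots> = (E2 n - (E1 n)\<^sup>2) / (real n * (h n ^ ?d)\<^sup>2)"
      using that by (simp only: var_sum) (simp add: power2_eq_square)
    finally show ?thesis .
  qed
  \<comment> \<open>\<open>h 0\<close> is unconstrained, so positivity is available from index 1
    on.\<close>
  have h_ev: "eventually (\<lambda>n. h n > 0) sequentially"
    using assms(13) by (auto simp: eventually_sequentially)
  have w_bound: "\<bar>f x * a x ^ k\<bar> \<le> C * A ^ k" for x k
    unfolding abs_mult power_abs using A f_nonneg fC aA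
    by (intro mult_mono power_mono) (auto intro: order_trans[OF f_nonneg fC])
  have w_cont: "continuous_on UNIV (\<lambda>x. f x * a x ^ k)" for k
    by (intro continuous_intros f_cont a_cont)
  \<comment> \<open>The factor a^d in the weight cancels the Jacobian, and K integrates to 1, which
    leaves f(t).\<close>
  have "(\<lambda>n. E1 n / h n ^ ?d) \<longlonglongrightarrow>
      f t * a t ^ ?d * (LINT u|lborel. K u) / a t ^ DIM(real ^ 'd)"
    using tendsto_integral_localized_kernel[OF a_cont a_ge assms(11) w_cont[of ?d] w_bound[of _ ?d]
        K_cont K_supp assms(14) h_ev, where t=t]
    by (simp add: E1_def g_def mult.assoc)
  then have E1_lim: "(\<lambda>n. E1 n / h n ^ ?d) \<longlonglongrightarrow> f t"
    using a_pos[of t] assms(10) by simp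
  have K2_cont: "continuous_on UNIV (\<lambda>x. (K x)\<^sup>2)"
    by (intro continuous_intros K_cont)
  have K2_supp: "norm x > sqrt \<bar>T\<bar> \<Longrightarrow> (K x)\<^sup>2 = 0" for x
    using K_supp by simp
  \<comment> \<open>Squaring doubles the exponent: one a^d will cancel the Jacobian, the other
    survives in the leading constant.\<close>
  have g_sq: "f x * (g m x)\<^sup>2 =
      f x * a x ^ (?d + ?d) * (K ((inverse (h m) * a x) *\<^sub>R (t - x)))\<^sup>2" for m x
    by (simp add: g_def power_mult_distrib power_add power2_eq_square[of "a x ^ ?d"])
  have "(\<lambda>n. E2 n / h n ^ ?d) \<longlonglongrightarrow> f t * a t ^ (?d + ?d) * ?\<mu> / a t ^ DIM(real ^ 'd)"
    using tendsto_integral_localized_kernel[OF a_cont a_ge assms(11) w_cont[of "?d + ?d"]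
        w_bound[of _ "?d + ?d"] K2_cont K2_supp assms(14) h_ev, where t=t]
    by (simp add: E2_def g_sq)
  then have E2_lim: "(\<lambda>n. E2 n / h n ^ ?d) \<longlonglongrightarrow> a t ^ ?d * f t * ?\<mu>"
    using a_pos[of t] by (simp add: power_add mult_ac)
  \<comment> \<open>For n >= 1 this is n h^d times the variance of the estimator, with the squared
    mean written as h^d times the square of a convergent sequence.\<close>
  define V where "V n = E2 n / h n ^ ?d - h n ^ ?d * (E1 n / h n ^ ?d)\<^sup>2" for n
  \<comment> \<open>The term \<open>0 ^ ?d\<close> is 0 because the dimension is positive; so the
    squared mean disappears in the limit.\<close>
  have "V \<longlonglongrightarrow> a t ^ ?d * f t * ?\<mu> - 0 ^ ?d * (f t)\<^sup>2"
    unfolding V_def by (intro tendsto_intros E1_lim E2_lim assms(14))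
  then have V_lim: "V \<longlonglongrightarrow> a t ^ ?d * f t * ?\<mu>" by (simp add: power_0_left)
  have "integrable lborel (\<lambda>x. B * K x)" using assms(9) by simp
  \<comment> \<open>K^2 is dominated by B |K|.\<close>
  then have "integrable lborel (\<lambda>x. (K x)\<^sup>2)"
  proof (rule Bochner_Integration.integrable_bound)
    have "norm ((K x)\<^sup>2) \<le> norm (B * K x)" for x
      using mult_right_mono[OF B(2)[of x], of "\<bar>K x\<bar>"] B(1)
      by (simp add: power2_eq_square abs_mult)
    then show "AE x in lborel. norm ((K x)\<^sup>2) \<le> norm (B * K x)" by simp
  qed simp
  then have \<mu>_pos: "?\<mu> > 0"
    by (rule integral_square_pos) (simp add: assms(10))
  \<comment> \<open>Since t0 >= 1, the threshold is nonnegative, so f(t) > 0 and \<open>lead\<close>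
    is nonzero.\<close>
  have "t0 * c\<^sup>2 \<ge> 0"
    using assms(12) by (auto simp: clipping_function_def)
  then have f_pos: "f t > 0" using assms(16) by linarith
  define lead where "lead = a t ^ ?d * f t * ?\<mu>"
  have lead: "lead > 0"
    unfolding lead_def using a_pos[of t] f_pos \<mu>_pos by simp
  \<comment> \<open>The witness for \<epsilon> comes from solving
    \<open>V n = lead * (1 + \<epsilon> n)\<close>; the variance formula is then an exact identity
    for every n >= 1.\<close>
  have "(\<lambda>n. V n / lead - 1) \<longlonglongrightarrow> lead / lead - 1"
    using V_lim lead unfolding lead_def[symmetric] by (intro tendsto_intros) auto
  then have "(\<lambda>n. V n / lead - 1) \<in> o(\<lambda>_. 1)"
    using lead by (intro smalloI_tendsto) auto
  moreover have "variance (ideal_estimator ?\<alpha> K f X n (h n) t) =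
      ?\<alpha> (f t) ^ ?d * f t * ?\<mu> / (real n * h n ^ ?d) * (1 + (V n / lead - 1))"
    if "n \<ge> 1" for n
  proof -
    have "?\<alpha> (f t) ^ ?d * f t * ?\<mu> / (real n * h n ^ ?d) * (1 + (V n / lead - 1)) =
        V n / (real n * h n ^ ?d)"
      unfolding a_def[symmetric] lead_def[symmetric] using lead by simp
    also have "\<dots> = (E2 n - (E1 n)\<^sup>2) / (real n * (h n ^ ?d)\<^sup>2)"
      using assms(13)[OF that] that by (simp add: V_def power2_eq_square field_simps)
    finally show ?thesis using var_est[OF that] by simp
  qed
  ultimately show ?thesis by (intro bexI[of _ "\<lambda>n. V n / lead - 1"] allI impI)
qed

end
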